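(* Let $A\subset\mathbb{R}^n$ be a nonempty finite set. Then the DSONC cone $D_A$ is a closed, convex, pointed cone in $\mathbb{R}^A$ which is full-dimensional (i.e. has nonempty interior in $\mathbb{R}^A$).
   Context: For a finite set $A\subset\mathbb{R}^n$, $\mathbb{R}^A$ denotes the real vector space of exponential sums $f(x)=\sum_{\alpha\in A}c_\alpha e^{\langle x,\alpha\rangle}$, $x\in\mathbb{R}^n$, with $c_\alpha\in\mathbb{R}$; it is identified with $\mathbb{R}^{\#A}$ (with its usual topology) via the coefficient vector. For $A^+\subset\mathbb{R}^n$ finite and $\beta\in\mathbb{R}^n$ let $\Lambda(A^+,\beta)=\{\lambda\in\mathbb{R}_{\ge0}^{A^+}:\sum_{\alpha\in A^+}\lambda_\alpha\alpha=\beta,\ \sum_{\alpha\in A^+}\lambda_\alpha=1\}$. For $\beta\in\mathrm{conv}(A^+)\setminus A^+$ let $D_{A^+,\beta}$ be the set of all $f(x)=\sum_{\alpha\in A^+}c_\alpha e^{\langle x,\alpha\rangle}+c_\beta e^{\langle x,\beta\rangle}$ with $c_\alpha\ge0$ for all $\alpha\in A^+$ and such that either $c_\beta\ge0$, or $|c_\beta|\le\prod_{\alpha\in A^+}c_\alpha^{\lambda_\alpha}$ for all $\lambda\in\Lambda(A^+,\beta)$ (convention $0^0=1$). DSONC cone: $D_A\subset\mathbb{R}^A$ is the convex cone generated by the exponential monomials $e^{\langle x,\alpha\rangle}$, $\alpha\in A$, together with all sets $D_{A^+,\beta}$ where $A^+\subseteq A$ and $\beta\in A\setminus A^+$ with $\beta\in\mathrm{conv}(A^+)$.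 A convex cone $K$ is pointed if $K\cap(-K)=\{0\}$. *)

theory Defs
  imports "HOL-Analysis.Analysis" "HOL-Library.Function_Algebras"
begin

text \<open>Addition and negation of functions are pointwise (\<^theory>\<open>HOL-Library.Function_Algebras\<close>);
  pointwise scaling makes \<^const>\<open>convex\<close>, \<^const>\<open>convex_cone\<close> and \<^const>\<open>hull\<close> applicable to sets
  of real-valued functions.\<close>

instantiation "fun" :: (type, real_vector) real_vector
begin

definition scaleR_fun :: "real \<Rightarrow> ('a \<Rightarrow> 'b) \<Rightarrow> 'a \<Rightarrow> 'b" where
  "scaleR_fun r f = (\<lambda>x. r *\<^sub>R f x)"

instance
  by standard (simp_all add: scaleR_fun_def fun_eq_iff scaleR_add_right scaleR_add_left)

end

definition expmon :: "real ^ 'n \<Rightarrow> real ^ 'n \<Rightarrow> real" where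
  "expmon \<alpha> = (\<lambda>x. exp (x \<bullet> \<alpha>))"

definition expsum :: "(real ^ 'n) set \<Rightarrow> (real ^ 'n \<Rightarrow> real) \<Rightarrow> real ^ 'n \<Rightarrow> real" where
  "expsum A c = (\<lambda>x. \<Sum>\<alpha>\<in>A. c \<alpha> * exp (x \<bullet> \<alpha>))"

text \<open>The space \<open>\<real>\<^sup>A\<close> of exponential sums supported on \<open>A\<close>. Coefficient vectors are the functions
  on \<open>A\<close>, represented as elements of \<^term>\<open>extensional A\<close>.\<close>

definition expsums :: "(real ^ 'n) set \<Rightarrow> (real ^ 'n \<Rightarrow> real) set" where
  "expsums A = expsum A ` extensional A"

definition coeffvec :: "(real ^ 'n) set \<Rightarrow> (real ^ 'n \<Rightarrow> real) \<Rightarrow> real ^ 'n \<Rightarrow> real" where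
  "coeffvec A = inv_into (extensional A) (expsum A)"

text \<open>The topology of the coefficient space, transported along the identification of an exponential
  sum with its coefficient vector.\<close>

definition expsum_topology :: "(real ^ 'n) set \<Rightarrow> (real ^ 'n \<Rightarrow> real) topology" where
  "expsum_topology A = pullback_topology (expsums A) (coeffvec A) (powertop_real A)"

text \<open>The identification is well defined: exponentials with distinct exponents are linearly
  independent.\<close>

lemma expsum_eq_0_imp:
  fixes A :: "(real ^ 'n) set"
  assumes "finite A" "\<And>x. expsum A c x = 0" "\<alpha> \<in> A"
  shows "c \<alpha> = 0"
  using assms
proof (induction "card A" arbitrary: A \<alpha>)
  case 0
  then show ?case by simp
next
  case (Suc k)
  have ne: "A \<noteq> {}" using Suc.prems by blast
  define m where "m = Max (norm ` A)"
  have "m \<in> norm ` A" unfolding m_def using Suc.prems ne by (intro Max_in) auto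
  then obtain a where a: "a \<in> A" "norm a = m" by blast
  have le: "norm b \<le> norm a" if "b \<in> A" for b
    unfolding a m_def using Suc.prems that by (intro Max_ge) auto
  have neg: "a \<bullet> b - a \<bullet> a < 0" if "b \<in> A - {a}" for b
  proof -
    have "0 < (a - b) \<bullet> (a - b)" using that by auto
    moreover have "b \<bullet> b \<le> a \<bullet> a" using le[of b] that by (simp add: norm_le)
    ultimately show ?thesis by (simp add: inner_diff inner_commute)
  qed
  have lim: "((\<lambda>t. c a + (\<Sum>b\<in>A - {a}. c b * exp (t * (a \<bullet> b - a \<bullet> a)))) \<longlongrightarrow> c a + (\<Sum>b\<in>A - {a}. c b * 0)) at_top"
  proof (intro tendsto_intros)
    fix b assume b: "b \<in> A - {a}"
    have "filterlim (\<lambda>t. (a \<bullet> b - a \<bullet> a) * t) at_bot at_top"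
      by (rule filterlim_tendsto_neg_mult_at_bot[OF tendsto_const neg[OF b] filterlim_ident])
    then have "filterlim (\<lambda>t. t * (a \<bullet> b - a \<bullet> a)) at_bot at_top"
      by (simp add: mult.commute)
    then show "((\<lambda>t. exp (t * (a \<bullet> b - a \<bullet> a))) \<longlongrightarrow> 0) at_top"
      by (rule filterlim_compose[OF exp_at_bot])
  qed
  have "c a + (\<Sum>b\<in>A - {a}. c b * exp (t * (a \<bullet> b - a \<bullet> a))) = 0" for t
  proof -
    have "0 = exp (- (t * (a \<bullet> a))) * expsum A c (t *\<^sub>R a)" using Suc.prems by simp
    also have "\<dots> = (\<Sum>b\<in>A. c b * exp (t * (a \<bullet> b - a \<bullet> a)))"
      by (simp add: expsum_def sum_distrib_left right_diff_distrib exp_diff exp_minus field_simps)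
    also have "\<dots> = c a + (\<Sum>b\<in>A - {a}. c b * exp (t * (a \<bullet> b - a \<bullet> a)))"
      using Suc.prems a by (subst sum.remove[of A a]) auto
    finally show ?thesis by simp
  qed
  with lim have "((\<lambda>t::real. 0) \<longlongrightarrow> c a) at_top" by simp
  then have ca: "c a = 0"
    using tendsto_unique[OF trivial_limit_at_top_linorder tendsto_const] by metis
  show ?case
  proof (cases "\<alpha> = a")
    case False
    have "expsum (A - {a}) c x = 0" for x
      using Suc.prems(2)[of x] Suc.prems a ca by (simp add: expsum_def sum.remove[of A a])
    then show ?thesis using False Suc a by (intro Suc.hyps(1)[of "A - {a}"]) auto
  qed (use ca in simp)
qed

lemma inj_on_expsum:
  fixes A :: "(real ^ 'n) set"
  assumes "finite A"
  shows "inj_on (expsum A) (extensional A)"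
proof (intro inj_onI)
  fix c d :: "real ^ 'n \<Rightarrow> real"
  assume cd: "c \<in> extensional A" "d \<in> extensional A" "expsum A c = expsum A d"
  have "expsum A (\<lambda>\<alpha>. c \<alpha> - d \<alpha>) x = 0" for x
    using fun_cong[OF cd(3), of x] by (simp add: expsum_def left_diff_distrib sum_subtractf)
  then have "c \<alpha> - d \<alpha> = 0" if "\<alpha> \<in> A" for \<alpha>
    using expsum_eq_0_imp[OF assms, of "\<lambda>\<alpha>. c \<alpha> - d \<alpha>"] that by blast
  then show "c = d" using cd by (intro extensionalityI) auto
qed

definition Lam :: "(real ^ 'n) set \<Rightarrow> real ^ 'n \<Rightarrow> (real ^ 'n \<Rightarrow> real) set" where
  "Lam Ap \<beta> = {l \<in> Ap \<rightarrow>\<^sub>E {0..}. (\<Sum>\<alpha>\<in>Ap. l \<alpha> *\<^sub>R \<alpha>) = \<beta> \<and> (\<Sum>\<alpha>\<in>Ap. l \<alpha>) = 1}"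

text \<open>Real powers with the convention \<open>0\<^sup>0 = 1\<close>; note \<open>0 powr 0 = 0\<close> in the library.\<close>

definition powr01 :: "real \<Rightarrow> real \<Rightarrow> real" where
  "powr01 c l = (if l = 0 then 1 else c powr l)"

definition dsonc_atom :: "(real ^ 'n) set \<Rightarrow> real ^ 'n \<Rightarrow> (real ^ 'n \<Rightarrow> real) set" where
  "dsonc_atom Ap \<beta> = {f. \<exists>c b. f = (\<lambda>x. (\<Sum>\<alpha>\<in>Ap. c \<alpha> * exp (x \<bullet> \<alpha>)) + b * exp (x \<bullet> \<beta>)) \<and>
     (\<forall>\<alpha>\<in>Ap. 0 \<le> c \<alpha>) \<and>
     (0 \<le> b \<or> (\<forall>l\<in>Lam Ap \<beta>. \<bar>b\<bar> \<le> (\<Prod>\<alpha>\<in>Ap. powr01 (c \<alpha>) (l \<alpha>))))}"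

definition dsonc :: "(real ^ 'n) set \<Rightarrow> (real ^ 'n \<Rightarrow> real) set" where
  "dsonc A = convex_cone hull
     (expmon ` A \<union> \<Union> {dsonc_atom Ap \<beta> | Ap \<beta>. Ap \<subseteq> A \<and> \<beta> \<in> A - Ap \<and> \<beta> \<in> convex hull Ap})"

definition pointed :: "'a::real_vector set \<Rightarrow> bool" where
  "pointed K \<longleftrightarrow> K \<inter> uminus ` K = {0}"

end

theory Submission
  imports Defs
begin

text \<open>Every generating cone consists of nonnegative functions whose coefficients are nonnegative
  except at one exponent \<open>\<beta>\<close>. For such an \<open>f\<close> the second difference
  \<open>exp (- \<langle>x, \<beta>\<rangle>) f(x) + exp \<langle>x, \<beta>\<rangle> f(-x) - 2 f(0)\<close> does not involve the coefficient at \<open>\<beta>\<close>; with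
  \<open>x = \<alpha> - \<beta>\<close> it bounds the coefficient at \<open>\<alpha>\<close> by values of \<open>f\<close>. Hence a single linear functional,
  the sum of the values of \<open>f\<close> on \<open>A - A\<close>, bounds all coefficients on every generating cone. By
  compactness this makes finite sums of closed cones closed; pointedness follows from nonnegativity
  alone, and the positive orthant gives interior points. The generating cones are convex and closed
  because weighted geometric means are superadditive and continuous, and their elements are
  nonnegative by the inequality of weighted arithmetic and geometric means.\<close>

subsection \<open>Weighted geometric means\<close>

lemma powr01_nonneg: "0 \<le> c \<Longrightarrow> 0 \<le> powr01 c l"
  by (simp add: powr01_def)

lemma powr01_mult: "0 \<le> c \<Longrightarrow> 0 \<le> d \<Longrightarrow> powr01 (c * d) l = powr01 c l * powr01 d l"
  by (simp add: powr01_def powr_mult)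

text \<open>Weights with sum 1 make the geometric mean homogeneous of degree one; this is the factor
  that appears when an element of an atom is scaled.\<close>

lemma prod_powr01_const:
  assumes "finite P" "0 < t" "(\<Sum>\<alpha>\<in>P. l \<alpha>) = 1"
  shows "(\<Prod>\<alpha>\<in>P. powr01 t (l \<alpha>)) = t"
proof -
  have "(\<Prod>\<alpha>\<in>P. powr01 t (l \<alpha>)) = (\<Prod>\<alpha>\<in>P. t powr l \<alpha>)"
    using assms by (intro prod.cong) (auto simp: powr01_def)
  also have "\<dots> = t powr (\<Sum>\<alpha>\<in>P. l \<alpha>)"
    using powr_sum[where x = t and A = P and f = l] assms(1,2) by simp
  finally show ?thesis using assms by simp
qed

text \<open>Jensen's inequality for \<open>exp\<close> at the points \<open>ln (c \<alpha>)\<close>.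
  A vanishing \<open>c \<alpha>\<close> of nonzero weight makes the product zero; one of weight zero
  contributes the factor 1 and the summand 0, so the value of its logarithm is irrelevant.\<close>

lemma prod_powr01_le_sum:
  fixes c l :: "'a \<Rightarrow> real"
  assumes "finite P" "\<And>\<alpha>. \<alpha> \<in> P \<Longrightarrow> 0 \<le> c \<alpha>" "\<And>\<alpha>. \<alpha> \<in> P \<Longrightarrow> 0 \<le> l \<alpha>" "(\<Sum>\<alpha>\<in>P. l \<alpha>) = 1"
  shows "(\<Prod>\<alpha>\<in>P. powr01 (c \<alpha>) (l \<alpha>)) \<le> (\<Sum>\<alpha>\<in>P. l \<alpha> * c \<alpha>)"
proof (cases "\<exists>\<alpha>\<in>P. l \<alpha> \<noteq> 0 \<and> c \<alpha> = 0")
  case True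
  then have "(\<Prod>\<alpha>\<in>P. powr01 (c \<alpha>) (l \<alpha>)) = 0"
    using assms(1) by (auto simp: powr01_def intro!: prod_zero)
  moreover have "0 \<le> (\<Sum>\<alpha>\<in>P. l \<alpha> * c \<alpha>)" using assms by (simp add: sum_nonneg)
  ultimately show ?thesis by (simp only:)
next
  case False
  define y where "y \<alpha> = ln (c \<alpha>)" for \<alpha>
  have pos: "0 < c \<alpha>" if "\<alpha> \<in> P" "l \<alpha> \<noteq> 0" for \<alpha>
    using False assms(2)[of \<alpha>] that by force
  have "P \<noteq> {}" using assms(4) by auto
  have "(\<Prod>\<alpha>\<in>P. powr01 (c \<alpha>) (l \<alpha>)) = (\<Prod>\<alpha>\<in>P. exp (l \<alpha> * y \<alpha>))"
    by (intro prod.cong refl) (use pos in \<open>force simp: powr01_def y_def powr_def\<close>)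
  also have "\<dots> = exp (\<Sum>\<alpha>\<in>P. l \<alpha> *\<^sub>R y \<alpha>)"
    using assms(1) by (simp add: exp_sum)
  also have "\<dots> \<le> (\<Sum>\<alpha>\<in>P. l \<alpha> * exp (y \<alpha>))"
    by (rule convex_on_sum[OF assms(1) \<open>P \<noteq> {}\<close> exp_convex assms(4)]) (use assms in auto)
  also have "\<dots> = (\<Sum>\<alpha>\<in>P. l \<alpha> * c \<alpha>)"
    by (intro sum.cong refl) (use pos in \<open>auto simp: y_def\<close>)
  finally show ?thesis .
qed

text \<open>After division by the mean of \<open>c + d\<close>, the means of the ratios
  \<open>c / (c + d)\<close> and \<open>d / (c + d)\<close> are bounded by their arithmetic means,
  and these add up to the total weight 1.\<close>

lemma prod_powr01_superadditive:
  fixes c d l :: "'a \<Rightarrow> real"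
  assumes "finite P" "\<And>\<alpha>. \<alpha> \<in> P \<Longrightarrow> 0 \<le> c \<alpha>" "\<And>\<alpha>. \<alpha> \<in> P \<Longrightarrow> 0 \<le> d \<alpha>"
    "\<And>\<alpha>. \<alpha> \<in> P \<Longrightarrow> 0 \<le> l \<alpha>" "(\<Sum>\<alpha>\<in>P. l \<alpha>) = 1"
  shows "(\<Prod>\<alpha>\<in>P. powr01 (c \<alpha>) (l \<alpha>)) + (\<Prod>\<alpha>\<in>P. powr01 (d \<alpha>) (l \<alpha>))
    \<le> (\<Prod>\<alpha>\<in>P. powr01 (c \<alpha> + d \<alpha>) (l \<alpha>))"
proof (cases "\<exists>\<alpha>\<in>P. l \<alpha> \<noteq> 0 \<and> c \<alpha> + d \<alpha> = 0")
  case True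
  then obtain \<alpha> where \<alpha>: "\<alpha> \<in> P" "l \<alpha> \<noteq> 0" "c \<alpha> + d \<alpha> = 0" by blast
  then have "c \<alpha> = 0" "d \<alpha> = 0" using assms(2,3)[OF \<alpha>(1)] by auto
  then have "(\<Prod>\<alpha>\<in>P. powr01 (c \<alpha>) (l \<alpha>)) = 0" "(\<Prod>\<alpha>\<in>P. powr01 (d \<alpha>) (l \<alpha>)) = 0"
    using assms(1) \<alpha> by (auto simp: powr01_def intro!: prod_zero bexI[of _ \<alpha>])
  moreover have "0 \<le> (\<Prod>\<alpha>\<in>P. powr01 (c \<alpha> + d \<alpha>) (l \<alpha>))"
    using assms by (auto intro!: prod_nonneg powr01_nonneg)
  ultimately show ?thesis by (simp only: add_0)
next
  case False
  define W where "W = (\<Prod>\<alpha>\<in>P. powr01 (c \<alpha> + d \<alpha>) (l \<alpha>))"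
  have W: "0 \<le> W" unfolding W_def using assms by (auto intro!: prod_nonneg powr01_nonneg)
  have scaled: "(\<Prod>\<alpha>\<in>P. powr01 (e \<alpha>) (l \<alpha>)) \<le> (\<Sum>\<alpha>\<in>P. l \<alpha> * (e \<alpha> / (c \<alpha> + d \<alpha>))) * W"
    if e: "\<And>\<alpha>. \<alpha> \<in> P \<Longrightarrow> 0 \<le> e \<alpha>" for e
  proof -
    have "(\<Prod>\<alpha>\<in>P. powr01 (e \<alpha>) (l \<alpha>)) = (\<Prod>\<alpha>\<in>P. powr01 (e \<alpha> / (c \<alpha> + d \<alpha>)) (l \<alpha>)) * W"
      unfolding W_def prod.distrib[symmetric]
    proof (intro prod.cong refl)
      fix \<alpha> assume \<alpha>: "\<alpha> \<in> P"
      show "powr01 (e \<alpha>) (l \<alpha>) = powr01 (e \<alpha> / (c \<alpha> + d \<alpha>)) (l \<alpha>) * powr01 (c \<alpha> + d \<alpha>) (l \<alpha>)"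
      proof (cases "l \<alpha> = 0")
        case False
        then have "c \<alpha> + d \<alpha> \<noteq> 0" using \<open>\<not> (\<exists>\<alpha>\<in>P. l \<alpha> \<noteq> 0 \<and> c \<alpha> + d \<alpha> = 0)\<close> \<alpha> by blast
        then show ?thesis
          using assms(2,3)[OF \<alpha>] e[OF \<alpha>] by (subst powr01_mult[symmetric]) auto
      qed (simp add: powr01_def)
    qed
    also have "\<dots> \<le> (\<Sum>\<alpha>\<in>P. l \<alpha> * (e \<alpha> / (c \<alpha> + d \<alpha>))) * W"
      by (intro mult_right_mono W prod_powr01_le_sum assms divide_nonneg_nonneg add_nonneg_nonneg e)
    finally show ?thesis .
  qed
  have "(\<Prod>\<alpha>\<in>P. powr01 (c \<alpha>) (l \<alpha>)) + (\<Prod>\<alpha>\<in>P. powr01 (d \<alpha>) (l \<alpha>))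
    \<le> (\<Sum>\<alpha>\<in>P. l \<alpha> * (c \<alpha> / (c \<alpha> + d \<alpha>))) * W + (\<Sum>\<alpha>\<in>P. l \<alpha> * (d \<alpha> / (c \<alpha> + d \<alpha>))) * W"
    using scaled[of c] scaled[of d] assms by (intro add_mono) auto
  also have "\<dots> = (\<Sum>\<alpha>\<in>P. l \<alpha> * (c \<alpha> / (c \<alpha> + d \<alpha>) + d \<alpha> / (c \<alpha> + d \<alpha>))) * W"
    by (simp add: distrib_right distrib_left sum.distrib)
  also have "(\<Sum>\<alpha>\<in>P. l \<alpha> * (c \<alpha> / (c \<alpha> + d \<alpha>) + d \<alpha> / (c \<alpha> + d \<alpha>))) = (\<Sum>\<alpha>\<in>P. l \<alpha>)"
    \<comment> \<open>Where \<open>c \<alpha> + d \<alpha> = 0\<close> the quotients are 0 rather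
      than adding up to 1, but there the weight is zero in the present case.\<close>
    by (intro sum.cong refl) (use False in \<open>auto simp: add_divide_distrib[symmetric]\<close>)
  finally show ?thesis using assms(5) by (simp add: W_def)
qed

text \<open>The weights stay fixed along the sequence, so the jump of the convention at exponent 0
  does no harm: each factor is constantly 1 or a positive power, which is continuous up to the
  boundary point 0.\<close>

lemma tendsto_prod_powr01:
  fixes s :: "nat \<Rightarrow> 'a \<Rightarrow> real"
  assumes "\<And>k \<alpha>. \<alpha> \<in> P \<Longrightarrow> 0 \<le> s k \<alpha>" "\<And>\<alpha>. \<alpha> \<in> P \<Longrightarrow> 0 \<le> l \<alpha>"
    "\<And>\<alpha>. \<alpha> \<in> P \<Longrightarrow> (\<lambda>k. s k \<alpha>) \<longlonglongrightarrow> c \<alpha>"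
  shows "(\<lambda>k. \<Prod>\<alpha>\<in>P. powr01 (s k \<alpha>) (l \<alpha>)) \<longlonglongrightarrow> (\<Prod>\<alpha>\<in>P. powr01 (c \<alpha>) (l \<alpha>))"
proof (rule tendsto_prod)
  fix \<alpha> assume \<alpha>: "\<alpha> \<in> P"
  show "(\<lambda>k. powr01 (s k \<alpha>) (l \<alpha>)) \<longlonglongrightarrow> powr01 (c \<alpha>) (l \<alpha>)"
  proof (cases "l \<alpha> = 0")
    case False
    then have "0 < l \<alpha>" using assms(2)[OF \<alpha>] by simp
    then show ?thesis
      using assms \<alpha> by (simp add: powr01_def) (intro tendsto_powr' tendsto_const, auto)
  qed (simp add: powr01_def)
qed

subsection \<open>Exponential sums\<close>

lemma expsum_cong: "(\<And>\<alpha>. \<alpha> \<in> A \<Longrightarrow> c \<alpha> = d \<alpha>) \<Longrightarrow> expsum A c = expsum A d"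
  by (auto simp: expsum_def fun_eq_iff intro!: sum.cong)

lemma expsum_in_expsums: "expsum A c \<in> expsums A"
proof -
  have "expsum A c = expsum A (restrict c A)" by (rule expsum_cong) simp
  then show ?thesis unfolding expsums_def by blast
qed

lemma expsums_obtain:
  assumes "f \<in> expsums A" obtains c where "f = expsum A c"
  using assms by (auto simp: expsums_def)

lemma expsum_add: "expsum A c + expsum A d = expsum A (\<lambda>\<alpha>. c \<alpha> + d \<alpha>)"
  by (simp add: expsum_def fun_eq_iff distrib_right sum.distrib)

lemma expsum_scaleR: "t *\<^sub>R expsum A c = expsum A (\<lambda>\<alpha>. t * c \<alpha>)"
  by (simp add: expsum_def scaleR_fun_def fun_eq_iff sum_distrib_left mult.assoc)

lemma expsum_eq_iff:
  assumes "finite A"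
  shows "expsum A c = expsum A d \<longleftrightarrow> (\<forall>\<alpha>\<in>A. c \<alpha> = d \<alpha>)"
proof
  assume eq: "expsum A c = expsum A d"
  have "expsum A (\<lambda>\<alpha>. c \<alpha> - d \<alpha>) x = 0" for x
    using fun_cong[OF eq, of x] by (simp add: expsum_def left_diff_distrib sum_subtractf)
  then show "\<forall>\<alpha>\<in>A. c \<alpha> = d \<alpha>"
    using expsum_eq_0_imp[OF assms, of "\<lambda>\<alpha>. c \<alpha> - d \<alpha>"] by fastforce
qed (auto intro: expsum_cong)

lemma expmon_eq_expsum:
  assumes "finite A" "\<alpha> \<in> A"
  shows "expmon \<alpha> = expsum A (\<lambda>\<gamma>. if \<gamma> = \<alpha> then 1 else 0)"
proof
  fix x
  have "expsum A (\<lambda>\<gamma>. if \<gamma> = \<alpha> then 1 else 0) x = (\<Sum>\<gamma>\<in>A. if \<gamma> = \<alpha> then exp (x \<bullet> \<gamma>) else 0)"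
    unfolding expsum_def by (intro sum.cong) auto
  then show "expmon \<alpha> x = expsum A (\<lambda>\<gamma>. if \<gamma> = \<alpha> then 1 else 0) x"
    using assms by (simp add: expmon_def)
qed

lemma tendsto_expsum:
  assumes "\<And>\<alpha>. \<alpha> \<in> A \<Longrightarrow> (\<lambda>k. s k \<alpha>) \<longlonglongrightarrow> c \<alpha>"
  shows "(\<lambda>k. expsum A (s k) x) \<longlonglongrightarrow> expsum A c x"
  unfolding expsum_def by (intro tendsto_intros assms)

section \<open>The coefficient topology and closedness by sequences\<close>

lemma coeffvec_expsum:
  assumes "finite A"
  shows "coeffvec A (expsum A c) = restrict c A"
proof -
  have "expsum A c = expsum A (restrict c A)" by (rule expsum_cong) simp
  then show ?thesis
    unfolding coeffvec_def using inv_into_f_f[OF inj_on_expsum[OF assms], of "restrict c A"] by simp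
qed

lemma topspace_expsum_topology:
  assumes "finite A"
  shows "topspace (expsum_topology A) = expsums A"
proof -
  have "coeffvec A f \<in> extensional A" if "f \<in> expsums A" for f
    using that coeffvec_expsum[OF assms] by (auto elim!: expsums_obtain)
  then show ?thesis
    by (auto simp: expsum_topology_def topspace_pullback_topology PiE_def)
qed

text \<open>A full box is open in the product topology because \<open>A\<close> is finite. Such
  boxes serve as neighbourhoods for closure points and as the open set inside the DSONC
  cone.\<close>

lemma openin_expsum_box:
  assumes "finite A" "\<And>\<alpha>. open (U \<alpha>)"
  shows "openin (expsum_topology A) {expsum A c |c. \<forall>\<alpha>\<in>A. c \<alpha> \<in> U \<alpha>}"
proof -
  have "openin (powertop_real A) (PiE A U)"
    using assms by (simp add: openin_PiE)
  moreover have "{expsum A c |c. \<forall>\<alpha>\<in>A. c \<alpha> \<in> U \<alpha>} = coeffvec A -` PiE A U \<inter> expsums A"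
    using coeffvec_expsum[OF assms(1)]
    by (fastforce simp: expsum_in_expsums elim!: expsums_obtain)
  ultimately show ?thesis
    unfolding expsum_topology_def openin_pullback_topology by blast
qed

text \<open>Formulated with arbitrary coefficient functions, of which only the values on
  \<open>A\<close> matter, so that closedness of each cone reduces to limits of real
  sequences.\<close>

definition seq_closed :: "(real ^ 'n) set \<Rightarrow> (real ^ 'n \<Rightarrow> real) set \<Rightarrow> bool" where
  "seq_closed A S \<longleftrightarrow> (\<forall>s c. (\<forall>k::nat. expsum A (s k) \<in> S) \<longrightarrow>
     (\<forall>\<alpha>\<in>A. (\<lambda>k. s k \<alpha>) \<longlonglongrightarrow> c \<alpha>) \<longrightarrow> expsum A c \<in> S)"

lemma seq_closedD:
  "seq_closed A S \<Longrightarrow> (\<And>k. expsum A (s k) \<in> S) \<Longrightarrow> (\<And>\<alpha>. \<alpha> \<in> A \<Longrightarrow> (\<lambda>k. s k \<alpha>) \<longlonglongrightarrow> c \<alpha>)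
    \<Longrightarrow> expsum A c \<in> S"
  unfolding seq_closed_def by blast

text \<open>A closure point meets \<open>S\<close> in boxes of radius 1/(k+1) around its
  coefficients; one choice from each box gives a sequence in \<open>S\<close> converging to it
  coefficientwise.\<close>

lemma closedin_expsum_topology:
  assumes "finite A" "S \<subseteq> expsums A" "seq_closed A S"
  shows "closedin (expsum_topology A) S"
proof -
  let ?T = "expsum_topology A"
  have "f \<in> S" if f: "f \<in> ?T closure_of S" for f
  proof -
    have "f \<in> expsums A"
      using f closure_of_subset_topspace[of ?T S] by (auto simp: topspace_expsum_topology[OF assms(1)])
    then obtain c where c: "f = expsum A c" by (rule expsums_obtain)
    have "\<exists>d. expsum A d \<in> S \<and> (\<forall>\<alpha>\<in>A. d \<alpha> \<in> ball (c \<alpha>) (1 / real (Suc k)))" for k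
    proof -
      let ?B = "{expsum A d |d. \<forall>\<alpha>\<in>A. d \<alpha> \<in> ball (c \<alpha>) (1 / real (Suc k))}"
      have "openin ?T ?B" by (rule openin_expsum_box[OF assms(1)]) simp
      moreover have "f \<in> ?B" unfolding c by fastforce
      ultimately have "\<exists>g. g \<in> S \<and> g \<in> ?B"
        using f[unfolded in_closure_of, THEN conjunct2, rule_format, of ?B] by simp
      then show ?thesis by blast
    qed
    then obtain s where s: "\<And>k. expsum A (s k) \<in> S"
      "\<And>k \<alpha>. \<alpha> \<in> A \<Longrightarrow> dist (c \<alpha>) (s k \<alpha>) < 1 / real (Suc k)"
      by (metis mem_ball)
    have "(\<lambda>k. s k \<alpha>) \<longlonglongrightarrow> c \<alpha>" if "\<alpha> \<in> A" for \<alpha>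
    proof (rule metric_tendsto_imp_tendsto[OF LIMSEQ_Suc[OF lim_inverse_n]], intro always_eventually allI)
      fix k
      show "dist (s k \<alpha>) (c \<alpha>) \<le> dist (inverse (real (Suc k))) 0"
        using s(2)[OF that, of k] by (simp add: dist_commute inverse_eq_divide)
    qed
    then show ?thesis unfolding c by (rule seq_closedD[OF assms(3) s(1)])
  qed
  then have "?T closure_of S \<subseteq> S" by blast
  then show ?thesis
    using assms(2) by (simp add: closure_of_subset_eq[symmetric] topspace_expsum_topology[OF assms(1)])
qed

text \<open>Bolzano-Weierstrass, one coordinate at a time: each further subsequence keeps the
  coordinates already treated convergent.\<close>

lemma finite_bounded_convergent_subsequence:
  fixes s :: "nat \<Rightarrow> 'a \<Rightarrow> real"
  assumes "finite F" "\<And>\<alpha>. \<alpha> \<in> F \<Longrightarrow> bounded (range (\<lambda>k. s k \<alpha>))"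
  shows "\<exists>r. strict_mono r \<and> (\<forall>\<alpha>\<in>F. convergent (\<lambda>k. s (r k) \<alpha>))"
  using assms
proof (induction F rule: finite_induct)
  case empty
  then show ?case using strict_mono_id by blast
next
  case (insert \<alpha> F)
  then obtain r where r: "strict_mono r" "\<And>\<gamma>. \<gamma> \<in> F \<Longrightarrow> convergent (\<lambda>k. s (r k) \<gamma>)" by blast
  have "bounded (range (\<lambda>k. s (r k) \<alpha>))"
    by (rule bounded_subset[of "range (\<lambda>k. s k \<alpha>)"]) (use insert.prems in auto)
  then obtain l q where q: "strict_mono q" "((\<lambda>k. s (r k) \<alpha>) \<circ> q) \<longlonglongrightarrow> l"
    using bounded_imp_convergent_subsequence by blast
  have "convergent (\<lambda>k. s ((r \<circ> q) k) \<gamma>)" if "\<gamma> \<in> insert \<alpha> F" for \<gamma>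
  proof (cases "\<gamma> = \<alpha>")
    case True
    then show ?thesis using q(2) by (auto simp: convergent_def o_def)
  next
    case False
    then show ?thesis
      using convergent_subseq_convergent[OF r(2) q(1)] that by (simp add: o_def)
  qed
  then show ?case using strict_mono_o[OF r(1) q(1)] by blast
qed

subsection \<open>Closed cones with bounded coefficients\<close>

text \<open>Both orders of each pair occur, and the diagonal contributes \<open>f 0\<close>; for
  nonnegative \<open>f\<close> the functional therefore dominates all values that enter the second
  differences.\<close>

definition diff_values :: "(real ^ 'n) set \<Rightarrow> (real ^ 'n \<Rightarrow> real) \<Rightarrow> real" where
  "diff_values A f = (\<Sum>p\<in>A \<times> A. f (fst p - snd p))"

lemma diff_values_add: "diff_values A (f + g) = diff_values A f + diff_values A g"
  by (simp add: diff_values_def sum.distrib)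

lemma diff_values_nonneg: "(\<And>x. 0 \<le> f x) \<Longrightarrow> 0 \<le> diff_values A f"
  by (simp add: diff_values_def sum_nonneg)

lemma value_le_diff_values:
  assumes "finite A" "\<And>x. 0 \<le> f x" "\<alpha> \<in> A" "\<beta> \<in> A"
  shows "f (\<alpha> - \<beta>) \<le> diff_values A f"
proof -
  have "f (fst (\<alpha>, \<beta>) - snd (\<alpha>, \<beta>)) \<le> (\<Sum>p\<in>A \<times> A. f (fst p - snd p))"
    by (rule member_le_sum) (use assms in simp_all)
  then show ?thesis by (simp add: diff_values_def)
qed

text \<open>The invariant carried through the sum of the generating cones. Its last clause supplies
  the compactness: \<open>C\<close> depends on the cone and on \<alpha>, but not on the
  element.\<close>

definition bounded_cone :: "(real ^ 'n) set \<Rightarrow> (real ^ 'n \<Rightarrow> real) set \<Rightarrow> bool" where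
  "bounded_cone A S \<longleftrightarrow> S \<subseteq> expsums A \<and> convex_cone S \<and> seq_closed A S \<and> (\<forall>f\<in>S. \<forall>x. 0 \<le> f x) \<and>
     (\<forall>\<alpha>\<in>A. \<exists>C. \<forall>c. expsum A c \<in> S \<longrightarrow> \<bar>c \<alpha>\<bar> \<le> C * diff_values A (expsum A c))"

text \<open>Closedness is the crux. Along a convergent sequence \<open>s = p + q\<close> the
  functional of \<open>s\<close> is bounded; it is additive and nonnegative, so it is bounded on
  \<open>p\<close>, and with it the coefficients of \<open>p\<close>. A subsequence of
  \<open>p\<close> then converges, and \<open>q = s - p\<close> converges along it.\<close>

lemma bounded_cone_sums:
  fixes A :: "(real ^ 'n) set"
  assumes "finite A" "bounded_cone A S" "bounded_cone A T"
  shows "bounded_cone A (\<Union>f\<in>S. \<Union>g\<in>T. {f + g})"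
proof -
  let ?D = "diff_values A"
  from assms(2) have S: "S \<subseteq> expsums A" "convex_cone S" "seq_closed A S" "\<And>f x. f \<in> S \<Longrightarrow> 0 \<le> f x"
    "\<And>\<alpha>. \<alpha> \<in> A \<Longrightarrow> \<exists>C. \<forall>c. expsum A c \<in> S \<longrightarrow> \<bar>c \<alpha>\<bar> \<le> C * ?D (expsum A c)"
    unfolding bounded_cone_def by auto
  from assms(3) have T: "T \<subseteq> expsums A" "convex_cone T" "seq_closed A T" "\<And>f x. f \<in> T \<Longrightarrow> 0 \<le> f x"
    "\<And>\<alpha>. \<alpha> \<in> A \<Longrightarrow> \<exists>C. \<forall>c. expsum A c \<in> T \<longrightarrow> \<bar>c \<alpha>\<bar> \<le> C * ?D (expsum A c)"
    unfolding bounded_cone_def by auto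
  have split: "\<exists>p q. expsum A p \<in> S \<and> expsum A q \<in> T \<and> (\<forall>\<alpha>\<in>A. c \<alpha> = p \<alpha> + q \<alpha>) \<and>
      ?D (expsum A c) = ?D (expsum A p) + ?D (expsum A q)"
    if c: "expsum A c \<in> (\<Union>f\<in>S. \<Union>g\<in>T. {f + g})" for c
  proof -
    from c obtain f g where fg: "f \<in> S" "g \<in> T" "expsum A c = f + g" by blast
    obtain p q where pq: "f = expsum A p" "g = expsum A q"
      using S(1) T(1) fg by (meson expsums_obtain subsetD)
    have "\<forall>\<alpha>\<in>A. c \<alpha> = p \<alpha> + q \<alpha>"
      using fg(3) by (simp add: pq expsum_add expsum_eq_iff[OF assms(1)])
    then show ?thesis using fg pq diff_values_add by metis
  qed
  have "(\<Union>f\<in>S. \<Union>g\<in>T. {f + g}) \<subseteq> expsums A"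
  proof clarify
    fix f g assume "f \<in> S" "g \<in> T"
    then obtain p q where "f = expsum A p" "g = expsum A q"
      using S(1) T(1) by (meson expsums_obtain subsetD)
    then show "f + g \<in> expsums A" by (simp add: expsum_add expsum_in_expsums)
  qed
  moreover have "convex_cone (\<Union>f\<in>S. \<Union>g\<in>T. {f + g})"
    using S T by (intro convex_cone_sums)
  moreover have "\<forall>f\<in>\<Union>f\<in>S. \<Union>g\<in>T. {f + g}. \<forall>x. 0 \<le> f x"
    using S(4) T(4) by (auto intro!: add_nonneg_nonneg)
  moreover have "\<exists>C. \<forall>c. expsum A c \<in> (\<Union>f\<in>S. \<Union>g\<in>T. {f + g}) \<longrightarrow> \<bar>c \<alpha>\<bar> \<le> C * ?D (expsum A c)"
    if \<alpha>: "\<alpha> \<in> A" for \<alpha>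
  proof -
    obtain C where C: "\<And>c. expsum A c \<in> S \<Longrightarrow> \<bar>c \<alpha>\<bar> \<le> C * ?D (expsum A c)" using S(5)[OF \<alpha>] by blast
    obtain C' where C': "\<And>c. expsum A c \<in> T \<Longrightarrow> \<bar>c \<alpha>\<bar> \<le> C' * ?D (expsum A c)" using T(5)[OF \<alpha>] by blast
    have "\<bar>c \<alpha>\<bar> \<le> max C C' * ?D (expsum A c)" if c: "expsum A c \<in> (\<Union>f\<in>S. \<Union>g\<in>T. {f + g})" for c
    proof -
      from split[OF c] obtain p q where pq: "expsum A p \<in> S" "expsum A q \<in> T" "c \<alpha> = p \<alpha> + q \<alpha>"
        "?D (expsum A c) = ?D (expsum A p) + ?D (expsum A q)" using \<alpha> by blast
      have "\<bar>c \<alpha>\<bar> \<le> C * ?D (expsum A p) + C' * ?D (expsum A q)"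
        using C[OF pq(1)] C'[OF pq(2)] pq(3) by linarith
      \<comment> \<open>Enlarging the constants is monotone because the functional is nonnegative on
        both cones.\<close>
      also have "\<dots> \<le> max C C' * ?D (expsum A p) + max C C' * ?D (expsum A q)"
        using pq S(4) T(4) by (intro add_mono mult_right_mono diff_values_nonneg) auto
      finally show ?thesis by (simp add: pq(4) distrib_left)
    qed
    then show ?thesis by blast
  qed
  moreover have "seq_closed A (\<Union>f\<in>S. \<Union>g\<in>T. {f + g})"
    unfolding seq_closed_def
  proof (intro allI impI)
    fix s :: "nat \<Rightarrow> real ^ 'n \<Rightarrow> real" and c
    assume s: "\<forall>k. expsum A (s k) \<in> (\<Union>f\<in>S. \<Union>g\<in>T. {f + g})"
      and lim: "\<forall>\<alpha>\<in>A. (\<lambda>k. s k \<alpha>) \<longlonglongrightarrow> c \<alpha>"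
    obtain p q where pq: "\<And>k. expsum A (p k) \<in> S" "\<And>k. expsum A (q k) \<in> T"
      "\<And>k \<alpha>. \<alpha> \<in> A \<Longrightarrow> s k \<alpha> = p k \<alpha> + q k \<alpha>"
      "\<And>k. ?D (expsum A (s k)) = ?D (expsum A (p k)) + ?D (expsum A (q k))"
    proof -
      have "\<forall>k. \<exists>p q. expsum A p \<in> S \<and> expsum A q \<in> T \<and> (\<forall>\<alpha>\<in>A. s k \<alpha> = p \<alpha> + q \<alpha>) \<and>
          ?D (expsum A (s k)) = ?D (expsum A p) + ?D (expsum A q)"
        by (intro allI split s[rule_format])
      then show ?thesis unfolding choice_iff using that by blast
    qed
    have "(\<lambda>k. ?D (expsum A (s k))) \<longlonglongrightarrow> ?D (expsum A c)"
      unfolding diff_values_def using lim by (intro tendsto_sum tendsto_expsum) auto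
    then have "bounded (range (\<lambda>k. ?D (expsum A (s k))))"
      using convergent_imp_bounded by blast
    then obtain M where M: "\<And>k. \<bar>?D (expsum A (s k))\<bar> \<le> M"
      by (auto simp: bounded_iff)
    have "bounded (range (\<lambda>k. p k \<alpha>))" if \<alpha>: "\<alpha> \<in> A" for \<alpha>
    proof -
      obtain C where C: "\<And>c. expsum A c \<in> S \<Longrightarrow> \<bar>c \<alpha>\<bar> \<le> C * ?D (expsum A c)" using S(5)[OF \<alpha>] by blast
      have "\<bar>p k \<alpha>\<bar> \<le> \<bar>C\<bar> * M" for k
      proof -
        have "0 \<le> ?D (expsum A (p k))" "0 \<le> ?D (expsum A (q k))"
          using pq S(4) T(4) by (auto intro: diff_values_nonneg)
        then have *: "0 \<le> ?D (expsum A (p k))" "?D (expsum A (p k)) \<le> M"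
          using M[of k] pq(4)[of k] by linarith+
        have "\<bar>p k \<alpha>\<bar> \<le> C * ?D (expsum A (p k))" by (rule C[OF pq(1)])
        \<comment> \<open>No sign of \<open>C\<close> is known, hence the absolute value.\<close>
        also have "\<dots> \<le> \<bar>C\<bar> * M" using * by (intro mult_mono) auto
        finally show ?thesis .
      qed
      then show ?thesis by (auto simp: bounded_iff)
    qed
    then obtain r where r: "strict_mono r" "\<And>\<alpha>. \<alpha> \<in> A \<Longrightarrow> convergent (\<lambda>k. p (r k) \<alpha>)"
      using finite_bounded_convergent_subsequence[OF assms(1)] by blast
    define u where "u \<alpha> = lim (\<lambda>k. p (r k) \<alpha>)" for \<alpha>
    have u: "(\<lambda>k. p (r k) \<alpha>) \<longlonglongrightarrow> u \<alpha>" if "\<alpha> \<in> A" for \<alpha>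
      using r(2)[OF that] by (simp add: u_def convergent_LIMSEQ_iff)
    have v: "(\<lambda>k. q (r k) \<alpha>) \<longlonglongrightarrow> c \<alpha> - u \<alpha>" if "\<alpha> \<in> A" for \<alpha>
    proof -
      have "(\<lambda>k. s (r k) \<alpha>) \<longlonglongrightarrow> c \<alpha>"
        using LIMSEQ_subseq_LIMSEQ[OF lim[rule_format, OF that] r(1)] by (simp add: o_def)
      from tendsto_diff[OF this u[OF that]] show ?thesis using pq(3)[OF that] by simp
    qed
    have "expsum A u \<in> S" by (rule seq_closedD[OF S(3) pq(1) u])
    moreover have "expsum A (\<lambda>\<alpha>. c \<alpha> - u \<alpha>) \<in> T" by (rule seq_closedD[OF T(3) pq(2) v])
    moreover have "expsum A c = expsum A u + expsum A (\<lambda>\<alpha>. c \<alpha> - u \<alpha>)" by (simp add: expsum_add)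
    ultimately show "expsum A c \<in> (\<Union>f\<in>S. \<Union>g\<in>T. {f + g})" by blast
  qed
  ultimately show ?thesis unfolding bounded_cone_def by blast
qed

lemma bounded_cone_pointed:
  assumes "bounded_cone A S"
  shows "pointed S"
proof -
  have S: "convex_cone S" "\<And>f x. f \<in> S \<Longrightarrow> 0 \<le> f x"
    using assms unfolding bounded_cone_def by auto
  have "f = 0" if "f \<in> S" "- f \<in> S" for f
  proof
    fix x
    show "f x = 0 x" using S(2)[OF that(1), of x] S(2)[OF that(2), of x] by simp
  qed
  then have "S \<inter> uminus ` S \<subseteq> {0}" by auto
  moreover have "0 \<in> S" using S(1) by (rule convex_cone_contains_0)
  ultimately show ?thesis unfolding pointed_def by force
qed

text \<open>A nonnegative sum cannot hide a large coefficient at \<alpha> behind a negative one at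
  \<beta>: the second difference along \<alpha> - \<beta> annihilates the \<beta> term and weights
  all others nonnegatively. The coefficient at \<beta> itself is then recovered from the value at
  0.\<close>

lemma coefficient_bound:
  fixes A :: "(real ^ 'n) set"
  assumes A: "finite A" "\<beta> \<in> A" "\<alpha> \<in> A"
  shows "\<exists>C. \<forall>c. (\<forall>x. 0 \<le> expsum A c x) \<longrightarrow> (\<forall>\<gamma>\<in>A - {\<beta>}. 0 \<le> c \<gamma>) \<longrightarrow>
    \<bar>c \<alpha>\<bar> \<le> C * diff_values A (expsum A c)"
proof -
  let ?D = "\<lambda>c. diff_values A (expsum A c)"
  let ?H = "\<lambda>c. (\<forall>x. 0 \<le> expsum A c x) \<and> (\<forall>\<gamma>\<in>A - {\<beta>}. 0 \<le> c \<gamma>)"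
  have off: "\<exists>C. \<forall>c. ?H c \<longrightarrow> \<bar>c \<alpha>\<bar> \<le> C * ?D c" if \<alpha>: "\<alpha> \<in> A - {\<beta>}" for \<alpha>
  proof -
    define x where "x = \<alpha> - \<beta>"
    \<comment> \<open>The factor by which the second difference multiplies the coefficient at
      \<gamma>. It is the square of a hyperbolic sine up to a constant, so it is nonnegative, zero
      at \<beta>, and positive at \<alpha> by the choice of \<open>x\<close>.\<close>
    define w where "w \<gamma> = exp (x \<bullet> (\<gamma> - \<beta>)) + exp (- (x \<bullet> (\<gamma> - \<beta>))) - 2" for \<gamma>
    have w_eq: "w \<gamma> = (exp (x \<bullet> (\<gamma> - \<beta>) / 2) - exp (- (x \<bullet> (\<gamma> - \<beta>) / 2)))\<^sup>2" for \<gamma>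
      by (simp add: w_def power2_diff exp_double[symmetric] exp_add[symmetric])
    have w: "0 \<le> w \<gamma>" "w \<beta> = 0" for \<gamma> by (simp_all add: w_eq)
    have "0 < x \<bullet> x" using \<alpha> by (simp add: x_def)
    then have wa: "0 < w \<alpha>" unfolding w_eq x_def[symmetric] by simp
    have "\<bar>c \<alpha>\<bar> \<le> ((exp (- (x \<bullet> \<beta>)) + exp (x \<bullet> \<beta>)) / w \<alpha>) * ?D c" if H: "?H c" for c
    proof -
      let ?f = "expsum A c"
      have D: "?f x \<le> ?D c" "?f (- x) \<le> ?D c"
        using value_le_diff_values[of A ?f \<alpha> \<beta>] value_le_diff_values[of A ?f \<beta> \<alpha>] A \<alpha> H
        by (auto simp: x_def)
      have "c \<alpha> * w \<alpha> \<le> (\<Sum>\<gamma>\<in>A. c \<gamma> * w \<gamma>)"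
      proof (rule member_le_sum)
        fix \<gamma> assume "\<gamma> \<in> A - {\<alpha>}"
        then show "0 \<le> c \<gamma> * w \<gamma>" using H w by (cases "\<gamma> = \<beta>") auto
      qed (use \<alpha> A in auto)
      also have "\<dots> = exp (- (x \<bullet> \<beta>)) * ?f x + exp (x \<bullet> \<beta>) * ?f (- x) - 2 * ?f 0"
      proof -
        have "c \<gamma> * w \<gamma> = exp (- (x \<bullet> \<beta>)) * (c \<gamma> * exp (x \<bullet> \<gamma>))
            + exp (x \<bullet> \<beta>) * (c \<gamma> * exp (- x \<bullet> \<gamma>)) - 2 * (c \<gamma> * exp (0 \<bullet> \<gamma>))" for \<gamma>
          by (simp add: w_def inner_diff_right exp_diff exp_minus field_simps)
        then show ?thesis
          by (simp only: expsum_def sum_distrib_left sum.distrib sum_subtractf)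
      qed
      \<comment> \<open>The term with \<open>?f 0\<close> is dropped because that value is
        nonnegative.\<close>
      also have "\<dots> \<le> exp (- (x \<bullet> \<beta>)) * ?D c + exp (x \<bullet> \<beta>) * ?D c - 0"
        using H D by (intro diff_mono add_mono mult_left_mono) auto
      finally have "c \<alpha> * w \<alpha> \<le> (exp (- (x \<bullet> \<beta>)) + exp (x \<bullet> \<beta>)) * ?D c" by (simp add: distrib_right)
      then show ?thesis using wa H \<alpha> by (simp add: pos_le_divide_eq)
    qed
    then show ?thesis by blast
  qed
  show ?thesis
  proof (cases "\<alpha> = \<beta>")
    case False
    then show ?thesis using off[of \<alpha>] A by blast
  next
    case True
    obtain C where C: "\<And>\<gamma> c. \<gamma> \<in> A - {\<beta>} \<Longrightarrow> ?H c \<Longrightarrow> \<bar>c \<gamma>\<bar> \<le> C \<gamma> * ?D c"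
      using off by metis
    \<comment> \<open>\<open>c \<beta>\<close> is the value at 0, between 0 and \<open>?D c\<close>,
      minus the other coefficients. The 1 covers the value at 0 and the sum of the
      \<open>C \<gamma>\<close> covers those coefficients.\<close>
    have "\<bar>c \<beta>\<bar> \<le> (1 + (\<Sum>\<gamma>\<in>A - {\<beta>}. C \<gamma>)) * ?D c" if H: "?H c" for c
    proof -
      have f0: "expsum A c 0 = c \<beta> + (\<Sum>\<gamma>\<in>A - {\<beta>}. c \<gamma>)"
        using A by (simp add: expsum_def sum.remove)
      have "0 \<le> expsum A c 0" "expsum A c 0 \<le> ?D c"
        using H value_le_diff_values[of A "expsum A c" \<beta> \<beta>] A by auto
      moreover have "0 \<le> (\<Sum>\<gamma>\<in>A - {\<beta>}. c \<gamma>)" using H by (intro sum_nonneg) auto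
      moreover have "(\<Sum>\<gamma>\<in>A - {\<beta>}. c \<gamma>) \<le> (\<Sum>\<gamma>\<in>A - {\<beta>}. C \<gamma> * ?D c)"
        using C[OF _ H] by (intro sum_mono) fastforce
      ultimately show ?thesis
        using f0 by (simp add: distrib_right sum_distrib_right)
    qed
    then show ?thesis using True by blast
  qed
qed

lemma bounded_coneI:
  assumes "finite A" "\<beta> \<in> A" "S \<subseteq> expsums A" "convex_cone S" "seq_closed A S"
    "\<And>f x. f \<in> S \<Longrightarrow> 0 \<le> f x" "\<And>c \<gamma>. expsum A c \<in> S \<Longrightarrow> \<gamma> \<in> A - {\<beta>} \<Longrightarrow> 0 \<le> c \<gamma>"
  shows "bounded_cone A S"
proof -
  have "\<exists>C. \<forall>c. expsum A c \<in> S \<longrightarrow> \<bar>c \<alpha>\<bar> \<le> C * diff_values A (expsum A c)" if "\<alpha> \<in> A" for \<alpha>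
    using coefficient_bound[OF assms(1,2) that] assms(6,7) by meson
  then show ?thesis using assms unfolding bounded_cone_def by blast
qed

subsection \<open>The generating cones\<close>

definition orthant :: "(real ^ 'n) set \<Rightarrow> (real ^ 'n \<Rightarrow> real) set" where
  "orthant A = {expsum A c |c. \<forall>\<alpha>\<in>A. 0 \<le> c \<alpha>}"

lemma expsum_in_orthant_iff:
  assumes "finite A"
  shows "expsum A c \<in> orthant A \<longleftrightarrow> (\<forall>\<alpha>\<in>A. 0 \<le> c \<alpha>)"
  by (auto simp: orthant_def expsum_eq_iff[OF assms])

lemma convex_cone_orthant:
  assumes "finite A"
  shows "convex_cone (orthant A)"
proof -
  have "expsum A (\<lambda>_. 0) = 0" by (simp add: expsum_def fun_eq_iff)
  moreover have "expsum A (\<lambda>_. 0) \<in> orthant A" by (simp add: expsum_in_orthant_iff[OF assms])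
  ultimately have "0 \<in> orthant A" by simp
  moreover have "f + g \<in> orthant A" if fg: "f \<in> orthant A" "g \<in> orthant A" for f g
  proof -
    obtain c d where "f = expsum A c" "g = expsum A d" using fg by (auto simp: orthant_def)
    then show ?thesis using fg by (simp add: expsum_add expsum_in_orthant_iff[OF assms])
  qed
  moreover have "t *\<^sub>R f \<in> orthant A" if f: "f \<in> orthant A" "0 \<le> t" for f t
  proof -
    obtain c where "f = expsum A c" using f by (auto simp: orthant_def)
    then show ?thesis using f by (simp add: expsum_scaleR expsum_in_orthant_iff[OF assms])
  qed
  ultimately show ?thesis unfolding convex_cone_iff by blast
qed

lemma convex_cone_hull_expmon:
  assumes "finite A"
  shows "convex_cone hull (expmon ` A) = orthant A"
proof
  show "convex_cone hull (expmon ` A) \<subseteq> orthant A"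
    using convex_cone_orthant[OF assms]
    by (intro hull_minimal) (auto simp: expmon_eq_expsum[OF assms] expsum_in_orthant_iff[OF assms])
  have "expsum B c \<in> convex_cone hull (expmon ` A)" if "finite B" "B \<subseteq> A" "\<forall>\<alpha>\<in>A. 0 \<le> c \<alpha>" for B c
    using that
  proof (induction B rule: finite_induct)
    case empty
    have "expsum {} c = 0" by (simp add: expsum_def fun_eq_iff)
    then show ?case using convex_cone_hull_contains_0 by metis
  next
    case (insert \<alpha> B)
    have "expsum (insert \<alpha> B) c = c \<alpha> *\<^sub>R expmon \<alpha> + expsum B c"
      using insert.hyps by (simp add: expsum_def expmon_def scaleR_fun_def fun_eq_iff)
    moreover have "c \<alpha> *\<^sub>R expmon \<alpha> \<in> convex_cone hull (expmon ` A)"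
      using insert.prems by (intro convex_cone_hull_mul hull_inc) auto
    ultimately show ?case using insert by (metis convex_cone_hull_add insert_subset)
  qed
  then show "orthant A \<subseteq> convex_cone hull (expmon ` A)"
    using assms by (auto simp: orthant_def)
qed

lemma bounded_cone_orthant:
  assumes "finite A" "A \<noteq> {}"
  shows "bounded_cone A (orthant A)"
proof -
  \<comment> \<open>Any exponent can play the exceptional one, since no coefficient is
    negative.\<close>
  obtain \<beta> where \<beta>: "\<beta> \<in> A" using assms by blast
  show ?thesis
  proof (rule bounded_coneI[OF assms(1) \<beta>])
    show "orthant A \<subseteq> expsums A" by (auto simp: orthant_def expsum_in_expsums)
    show "convex_cone (orthant A)" by (rule convex_cone_orthant[OF assms(1)])
    show "seq_closed A (orthant A)"
      unfolding seq_closed_def expsum_in_orthant_iff[OF assms(1)]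
      by (meson LIMSEQ_le_const)
    show "0 \<le> f x" if "f \<in> orthant A" for f x
      using that by (auto simp: orthant_def expsum_def intro!: sum_nonneg)
    show "0 \<le> c \<gamma>" if "expsum A c \<in> orthant A" "\<gamma> \<in> A - {\<beta>}" for c \<gamma>
      using that by (simp add: expsum_in_orthant_iff[OF assms(1)])
  qed
qed

section \<open>The atoms of the DSONC cone\<close>

text \<open>Geometric means are nonnegative, so the two alternatives in the definition of an atom amount
  to the single inequality for \<open>- c \<beta>\<close> below.\<close>

lemma dsonc_atom_eq:
  assumes "finite A" "Ap \<subseteq> A" "\<beta> \<in> A - Ap"
  shows "dsonc_atom Ap \<beta> = {expsum A c |c. (\<forall>\<alpha>\<in>Ap. 0 \<le> c \<alpha>) \<and> (\<forall>\<alpha>\<in>A - insert \<beta> Ap. c \<alpha> = 0) \<and>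
    (\<forall>l\<in>Lam Ap \<beta>. - c \<beta> \<le> (\<Prod>\<alpha>\<in>Ap. powr01 (c \<alpha>) (l \<alpha>)))}"
    (is "?L = ?R")
proof
  have fin: "finite Ap" using assms finite_subset by blast
  have sum_eq: "expsum A c = (\<lambda>x. (\<Sum>\<alpha>\<in>Ap. c \<alpha> * exp (x \<bullet> \<alpha>)) + c \<beta> * exp (x \<bullet> \<beta>))"
    if "\<forall>\<alpha>\<in>A - insert \<beta> Ap. c \<alpha> = 0" for c
  proof
    fix x
    have "expsum A c x = (\<Sum>\<alpha>\<in>insert \<beta> Ap. c \<alpha> * exp (x \<bullet> \<alpha>))"
      unfolding expsum_def using assms that by (intro sum.mono_neutral_right) auto
    then show "expsum A c x = (\<Sum>\<alpha>\<in>Ap. c \<alpha> * exp (x \<bullet> \<alpha>)) + c \<beta> * exp (x \<bullet> \<beta>)"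
      using assms fin by simp
  qed
  have prod_nonneg: "0 \<le> (\<Prod>\<alpha>\<in>Ap. powr01 (c \<alpha>) (l \<alpha>))" if "\<forall>\<alpha>\<in>Ap. 0 \<le> c \<alpha>" for c l :: "_ \<Rightarrow> real"
    using that by (auto intro!: prod_nonneg powr01_nonneg)
  show "?L \<subseteq> ?R"
  proof
    fix f assume "f \<in> ?L"
    then obtain c b where f: "f = (\<lambda>x. (\<Sum>\<alpha>\<in>Ap. c \<alpha> * exp (x \<bullet> \<alpha>)) + b * exp (x \<bullet> \<beta>))"
      and c: "\<forall>\<alpha>\<in>Ap. 0 \<le> c \<alpha>"
      and b: "0 \<le> b \<or> (\<forall>l\<in>Lam Ap \<beta>. \<bar>b\<bar> \<le> (\<Prod>\<alpha>\<in>Ap. powr01 (c \<alpha>) (l \<alpha>)))"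
      unfolding dsonc_atom_def by blast
    \<comment> \<open>One coefficient function on \<open>A\<close> carrying both parts; there is no
      clash because \<beta> is not in \<open>Ap\<close>.\<close>
    define d where "d \<alpha> = (if \<alpha> = \<beta> then b else if \<alpha> \<in> Ap then c \<alpha> else 0)" for \<alpha>
    have d: "d \<beta> = b" "\<And>\<alpha>. \<alpha> \<in> Ap \<Longrightarrow> d \<alpha> = c \<alpha>" "\<forall>\<alpha>\<in>A - insert \<beta> Ap. d \<alpha> = 0"
      using assms by (auto simp: d_def)
    have "f = expsum A d" unfolding sum_eq[OF d(3)] f by (simp add: d)
    moreover have "- b \<le> (\<Prod>\<alpha>\<in>Ap. powr01 (c \<alpha>) (l \<alpha>))" if "l \<in> Lam Ap \<beta>" for l
      using b that prod_nonneg[OF c, of l] by fastforce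
    ultimately show "f \<in> ?R" using c d by (auto intro!: exI[of _ d])
  qed
  show "?R \<subseteq> ?L"
  proof
    fix f assume "f \<in> ?R"
    then obtain c where c: "f = expsum A c" "\<forall>\<alpha>\<in>Ap. 0 \<le> c \<alpha>" "\<forall>\<alpha>\<in>A - insert \<beta> Ap. c \<alpha> = 0"
      "\<forall>l\<in>Lam Ap \<beta>. - c \<beta> \<le> (\<Prod>\<alpha>\<in>Ap. powr01 (c \<alpha>) (l \<alpha>))" by blast
    then have "0 \<le> c \<beta> \<or> (\<forall>l\<in>Lam Ap \<beta>. \<bar>c \<beta>\<bar> \<le> (\<Prod>\<alpha>\<in>Ap. powr01 (c \<alpha>) (l \<alpha>)))" by auto
    then show "f \<in> ?L" unfolding dsonc_atom_def c(1) sum_eq[OF c(3)] using c(2) by blast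
  qed
qed

text \<open>By linear independence all coefficient functions of the same sum agree on
  \<open>A\<close>, so membership can be tested on the given one instead of an unknown
  witness.\<close>

lemma expsum_in_dsonc_atom_iff:
  assumes "finite A" "Ap \<subseteq> A" "\<beta> \<in> A - Ap"
  shows "expsum A c \<in> dsonc_atom Ap \<beta> \<longleftrightarrow> (\<forall>\<alpha>\<in>Ap. 0 \<le> c \<alpha>) \<and> (\<forall>\<alpha>\<in>A - insert \<beta> Ap. c \<alpha> = 0) \<and>
    (\<forall>l\<in>Lam Ap \<beta>. - c \<beta> \<le> (\<Prod>\<alpha>\<in>Ap. powr01 (c \<alpha>) (l \<alpha>)))"
    (is "_ \<longleftrightarrow> ?P c")
proof -
  have "?P c" if "expsum A c = expsum A d" "?P d" for d
  proof -
    have eq: "\<And>\<alpha>. \<alpha> \<in> A \<Longrightarrow> c \<alpha> = d \<alpha>" using that(1) by (simp add: expsum_eq_iff[OF assms(1)])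
    have "(\<Prod>\<alpha>\<in>Ap. powr01 (c \<alpha>) (l \<alpha>)) = (\<Prod>\<alpha>\<in>Ap. powr01 (d \<alpha>) (l \<alpha>))" for l
      using eq assms(2) by (intro prod.cong) auto
    then show ?thesis using that(2) eq assms by auto
  qed
  then show ?thesis unfolding dsonc_atom_eq[OF assms] by blast
qed

text \<open>Without a weight vector the inequality in an atom would be vacuous and its elements
  could take negative values.\<close>

lemma Lam_nonempty:
  assumes "finite Ap" "\<beta> \<in> convex hull Ap"
  shows "Lam Ap \<beta> \<noteq> {}"
proof -
  obtain u where "\<forall>\<alpha>\<in>Ap. 0 \<le> u \<alpha>" "sum u Ap = 1" "(\<Sum>\<alpha>\<in>Ap. u \<alpha> *\<^sub>R \<alpha>) = \<beta>"
    using assms by (auto simp: convex_hull_finite)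
  then have "restrict u Ap \<in> Lam Ap \<beta>" by (auto simp: Lam_def)
  then show ?thesis by blast
qed

lemma bounded_cone_dsonc_atom:
  fixes A :: "(real ^ 'n) set"
  assumes A: "finite A" "Ap \<subseteq> A" "\<beta> \<in> A - Ap" and hull: "\<beta> \<in> convex hull Ap"
  shows "bounded_cone A (dsonc_atom Ap \<beta>)"
proof -
  let ?K = "dsonc_atom Ap \<beta>"
  note iff = expsum_in_dsonc_atom_iff[OF A]
  have fin: "finite Ap" using A finite_subset by blast
  have Lam: "0 \<le> l \<alpha>" "(\<Sum>\<alpha>\<in>Ap. l \<alpha>) = 1" "(\<Sum>\<alpha>\<in>Ap. l \<alpha> *\<^sub>R \<alpha>) = \<beta>"
    if "l \<in> Lam Ap \<beta>" "\<alpha> \<in> Ap" for l \<alpha> using that by (auto simp: Lam_def)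
  \<comment> \<open>Supplies the element of \<open>Ap\<close> that the facts \<open>Lam\<close> take
    as a premise.\<close>
  have ne: "Ap \<noteq> {}" using hull by auto
  have sub: "?K \<subseteq> expsums A" by (auto simp: dsonc_atom_eq[OF A] expsum_in_expsums)
  have zero: "0 \<in> ?K"
  proof -
    have "expsum A (\<lambda>_. 0) = 0" by (simp add: expsum_def fun_eq_iff)
    moreover have "expsum A (\<lambda>_. 0) \<in> ?K" by (auto simp: iff intro!: prod_nonneg powr01_nonneg)
    ultimately show ?thesis by simp
  qed
  have add: "f + g \<in> ?K" if fg: "f \<in> ?K" "g \<in> ?K" for f g
  proof -
    obtain c d where cd: "f = expsum A c" "g = expsum A d" using fg sub by (meson expsums_obtain subsetD)
    note c = fg(1)[unfolded cd iff] and d = fg(2)[unfolded cd iff]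
    have "- (c \<beta> + d \<beta>) \<le> (\<Prod>\<alpha>\<in>Ap. powr01 (c \<alpha> + d \<alpha>) (l \<alpha>))" if l: "l \<in> Lam Ap \<beta>" for l
    proof -
      have "(\<Prod>\<alpha>\<in>Ap. powr01 (c \<alpha>) (l \<alpha>)) + (\<Prod>\<alpha>\<in>Ap. powr01 (d \<alpha>) (l \<alpha>))
        \<le> (\<Prod>\<alpha>\<in>Ap. powr01 (c \<alpha> + d \<alpha>) (l \<alpha>))"
        using fin c d l ne Lam by (intro prod_powr01_superadditive) auto
      moreover have "- c \<beta> \<le> (\<Prod>\<alpha>\<in>Ap. powr01 (c \<alpha>) (l \<alpha>))" "- d \<beta> \<le> (\<Prod>\<alpha>\<in>Ap. powr01 (d \<alpha>) (l \<alpha>))"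
        using c d l by auto
      ultimately show ?thesis by linarith
    qed
    then show ?thesis using c d by (simp add: cd expsum_add iff)
  qed
  have scale: "t *\<^sub>R f \<in> ?K" if f: "f \<in> ?K" and t: "0 \<le> t" for f t
  proof (cases "t = 0")
    case True
    then show ?thesis using zero by simp
  next
    case False
    then have t: "0 < t" using t by simp
    obtain c where cf: "f = expsum A c" using f sub by (meson expsums_obtain subsetD)
    note c = f[unfolded cf iff]
    have "- (t * c \<beta>) \<le> (\<Prod>\<alpha>\<in>Ap. powr01 (t * c \<alpha>) (l \<alpha>))" if l: "l \<in> Lam Ap \<beta>" for l
    proof -
      have "(\<Prod>\<alpha>\<in>Ap. powr01 (t * c \<alpha>) (l \<alpha>)) = (\<Prod>\<alpha>\<in>Ap. powr01 t (l \<alpha>) * powr01 (c \<alpha>) (l \<alpha>))"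
        using c t by (intro prod.cong powr01_mult) auto
      also have "\<dots> = t * (\<Prod>\<alpha>\<in>Ap. powr01 (c \<alpha>) (l \<alpha>))"
        using prod_powr01_const[OF fin t, of l] l ne Lam(2) by (auto simp: prod.distrib)
      finally have "(\<Prod>\<alpha>\<in>Ap. powr01 (t * c \<alpha>) (l \<alpha>)) = t * (\<Prod>\<alpha>\<in>Ap. powr01 (c \<alpha>) (l \<alpha>))" .
      moreover have "t * - c \<beta> \<le> t * (\<Prod>\<alpha>\<in>Ap. powr01 (c \<alpha>) (l \<alpha>))"
        using c l t by (intro mult_left_mono) auto
      ultimately show ?thesis by simp
    qed
    then show ?thesis using c t by (simp add: cf expsum_scaleR iff)
  qed
  have cone: "convex_cone ?K" unfolding convex_cone_iff using zero add scale by blast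
  have closed: "seq_closed A ?K"
    unfolding seq_closed_def
  proof (intro allI impI)
    fix s :: "nat \<Rightarrow> real ^ 'n \<Rightarrow> real" and c
    assume s: "\<forall>k. expsum A (s k) \<in> ?K" and lim: "\<forall>\<alpha>\<in>A. (\<lambda>k. s k \<alpha>) \<longlonglongrightarrow> c \<alpha>"
    have "0 \<le> c \<alpha>" if "\<alpha> \<in> Ap" for \<alpha>
      by (rule LIMSEQ_le_const[of "\<lambda>k. s k \<alpha>"]) (use s lim that A in \<open>auto simp: iff\<close>)
    moreover have "c \<alpha> = 0" if "\<alpha> \<in> A - insert \<beta> Ap" for \<alpha>
    proof -
      have "(\<lambda>k. s k \<alpha>) = (\<lambda>k. 0)" using s that by (auto simp: iff)
      then show ?thesis using lim that by (metis DiffD1 LIMSEQ_const_iff)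
    qed
    \<comment> \<open>Each weight vector gives a closed condition on the coefficients, so the limit
      is taken separately for each \<open>l\<close>.\<close>
    moreover have "- c \<beta> \<le> (\<Prod>\<alpha>\<in>Ap. powr01 (c \<alpha>) (l \<alpha>))" if l: "l \<in> Lam Ap \<beta>" for l
    proof (rule LIMSEQ_le)
      show "(\<lambda>k. - s k \<beta>) \<longlonglongrightarrow> - c \<beta>" using lim A by (intro tendsto_minus) auto
      show "(\<lambda>k. \<Prod>\<alpha>\<in>Ap. powr01 (s k \<alpha>) (l \<alpha>)) \<longlonglongrightarrow> (\<Prod>\<alpha>\<in>Ap. powr01 (c \<alpha>) (l \<alpha>))"
        using s lim A Lam[OF l] by (intro tendsto_prod_powr01) (auto simp: iff)
      show "\<exists>N. \<forall>k\<ge>N. - s k \<beta> \<le> (\<Prod>\<alpha>\<in>Ap. powr01 (s k \<alpha>) (l \<alpha>))"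
        using s l by (auto simp: iff)
    qed
    ultimately show "expsum A c \<in> ?K" by (simp add: iff)
  qed
  have nonneg: "0 \<le> f x" if f: "f \<in> ?K" for f x
  proof -
    obtain c where cf: "f = expsum A c" using f sub by (meson expsums_obtain subsetD)
    note c = f[unfolded cf iff]
    \<comment> \<open>A single weight vector is enough for nonnegativity.\<close>
    obtain l where l: "l \<in> Lam Ap \<beta>" using Lam_nonempty[OF fin hull] by blast
    have "l \<alpha> \<le> 1" if "\<alpha> \<in> Ap" for \<alpha>
      using member_le_sum[of \<alpha> Ap l] Lam[OF l] fin that by fastforce
    then have le: "l \<alpha> * (c \<alpha> * exp (x \<bullet> \<alpha>)) \<le> c \<alpha> * exp (x \<bullet> \<alpha>)" if "\<alpha> \<in> Ap" for \<alpha>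
      using that c by (intro mult_left_le_one_le) (auto simp: Lam[OF l that])
    \<comment> \<open>Since \<beta> is the mean of the \<alpha> with weights \<open>l\<close>, the
      monomial at \<beta> is the geometric mean of the monomials at \<alpha>; it can be absorbed
      into the bound for \<open>- c \<beta>\<close> before the means are compared.\<close>
    have "(\<Sum>\<alpha>\<in>Ap. l \<alpha> * (x \<bullet> \<alpha>)) = x \<bullet> \<beta>"
      using Lam(3)[OF l] ne by (auto simp: inner_sum_right[symmetric] inner_scaleR_right[symmetric]
          simp del: inner_scaleR_right)
    moreover have "powr01 (exp (x \<bullet> \<alpha>)) (l \<alpha>) = exp (l \<alpha> * (x \<bullet> \<alpha>))" for \<alpha>
      by (simp add: powr01_def powr_def)
    ultimately have exp_eq: "exp (x \<bullet> \<beta>) = (\<Prod>\<alpha>\<in>Ap. powr01 (exp (x \<bullet> \<alpha>)) (l \<alpha>))"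
      using fin by (simp add: exp_sum[symmetric])
    have "- c \<beta> * exp (x \<bullet> \<beta>) \<le> (\<Prod>\<alpha>\<in>Ap. powr01 (c \<alpha>) (l \<alpha>)) * exp (x \<bullet> \<beta>)"
      using c l by (intro mult_right_mono) auto
    also have "\<dots> = (\<Prod>\<alpha>\<in>Ap. powr01 (c \<alpha> * exp (x \<bullet> \<alpha>)) (l \<alpha>))"
      unfolding exp_eq prod.distrib[symmetric] using c by (intro prod.cong powr01_mult[symmetric]) auto
    also have "\<dots> \<le> (\<Sum>\<alpha>\<in>Ap. l \<alpha> * (c \<alpha> * exp (x \<bullet> \<alpha>)))"
      using fin c Lam[OF l] ne by (intro prod_powr01_le_sum) auto
    also have "\<dots> \<le> (\<Sum>\<alpha>\<in>Ap. c \<alpha> * exp (x \<bullet> \<alpha>))"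
      by (intro sum_mono le)
    finally have "0 \<le> (\<Sum>\<alpha>\<in>insert \<beta> Ap. c \<alpha> * exp (x \<bullet> \<alpha>))" using A fin by simp
    also have "\<dots> = f x"
      unfolding cf expsum_def using A c by (intro sum.mono_neutral_left) auto
    finally show ?thesis .
  qed
  show ?thesis
  proof (rule bounded_coneI[where \<beta> = \<beta>, OF A(1) _ sub cone closed])
    show "\<beta> \<in> A" using A by blast
    show "0 \<le> f x" if "f \<in> ?K" for f x using that by (rule nonneg)
    show "0 \<le> c \<gamma>" if "expsum A c \<in> ?K" "\<gamma> \<in> A - {\<beta>}" for c \<gamma>
      using that by (cases "\<gamma> \<in> Ap") (auto simp: iff)
  qed
qed

subsection \<open>The DSONC cone\<close>

text \<open>Each convex cone is its own hull, and the hull of a union is the sum of the two hulls,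
  so each new cone costs one use of \<open>bounded_cone_sums\<close>. The induction starts from the
  orthant.\<close>

lemma bounded_cone_hull_Union:
  assumes A: "finite A" "A \<noteq> {}" and F: "finite F" "\<And>K. K \<in> F \<Longrightarrow> bounded_cone A K"
  shows "bounded_cone A (convex_cone hull (expmon ` A \<union> \<Union>F))"
  using F
proof (induction F rule: finite_induct)
  case empty
  then show ?case
    using bounded_cone_orthant[OF A] by (simp add: convex_cone_hull_expmon[OF A(1)])
next
  case (insert K F)
  have "convex_cone K" using insert.prems by (simp add: bounded_cone_def)
  then have "convex_cone hull K = K" by (simp add: hull_same)
  moreover have "expmon ` A \<union> \<Union>(insert K F) = (expmon ` A \<union> \<Union>F) \<union> K" by blast
  ultimately have "convex_cone hull (expmon ` A \<union> \<Union>(insert K F))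
      = (\<Union>f\<in>convex_cone hull (expmon ` A \<union> \<Union>F). \<Union>g\<in>K. {f + g})"
    by (simp only: convex_cone_hull_Un[of "expmon ` A \<union> \<Union>F" K])
  then show ?case using insert by (simp add: bounded_cone_sums[OF A(1)])
qed

lemma bounded_cone_dsonc:
  assumes "finite A" "A \<noteq> {}"
  shows "bounded_cone A (dsonc A)"
proof -
  let ?F = "{dsonc_atom Ap \<beta> | Ap \<beta>. Ap \<subseteq> A \<and> \<beta> \<in> A - Ap \<and> \<beta> \<in> convex hull Ap}"
  \<comment> \<open>There are only finitely many atoms, which is what reduces the hull to a finite
    sum of cones.\<close>
  have "?F \<subseteq> (\<lambda>(Ap, \<beta>). dsonc_atom Ap \<beta>) ` (Pow A \<times> A)" by auto
  then have "finite ?F" by (rule finite_subset) (use assms in auto)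
  then show ?thesis
    unfolding dsonc_def
    by (rule bounded_cone_hull_Union[OF assms]) (use bounded_cone_dsonc_atom[OF assms(1)] in blast)
qed

theorem proposition4p1:
  fixes A :: "(real ^ 'n) set"
  assumes "finite A" and "A \<noteq> {}"
  shows "dsonc A \<subseteq> expsums A
    \<and> closedin (expsum_topology A) (dsonc A)
    \<and> convex_cone (dsonc A)
    \<and> pointed (dsonc A)
    \<and> (expsum_topology A) interior_of (dsonc A) \<noteq> {}"
proof -
  have K: "dsonc A \<subseteq> expsums A" "convex_cone (dsonc A)" "seq_closed A (dsonc A)"
    using bounded_cone_dsonc[OF assms] unfolding bounded_cone_def by auto
  \<comment> \<open>The open positive orthant, an open box contained in the cone generated by the
    monomials.\<close>
  let ?U = "{expsum A c |c. \<forall>\<alpha>\<in>A. c \<alpha> \<in> {0<..}}"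
  have "?U \<subseteq> orthant A" by (auto simp: orthant_def intro: less_imp_le)
  also have "\<dots> \<subseteq> dsonc A"
    unfolding dsonc_def convex_cone_hull_expmon[OF assms(1), symmetric] by (rule hull_mono) blast
  finally have "?U \<subseteq> (expsum_topology A) interior_of (dsonc A)"
    using openin_expsum_box[OF assms(1), of "\<lambda>_. {0<..}"] by (intro interior_of_maximal) auto
  moreover have "expsum A (\<lambda>_. 1) \<in> ?U" by fastforce
  ultimately have "(expsum_topology A) interior_of (dsonc A) \<noteq> {}" by blast
  then show ?thesis
    using K closedin_expsum_topology[OF assms(1) K(1,3)]
      bounded_cone_pointed[OF bounded_cone_dsonc[OF assms]] by blast
qed

end
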